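(* Let $k,m\in\mathbb{Z}_{>0}$. Let $V$ be a $k$-dimensional vector space over some field $K$. Let $(v_1,\dots,v_{mk})$ be a tuple of vectors in $V$. The tuple can be split into $m$ bases of $V$ if and only if the following condition holds: for any vector subspace $U\subset V$, $$|\{i\in\{1,\dots,mk\}\,:\,v_i\in U\}|\le m\cdot\dim U.$$
   Context: "The tuple can be split into $m$ bases of $V$" means that the index set $\{1,\dots,mk\}$ can be partitioned into $m$ subsets $I_1,\dots,I_m$ of $k$ elements each such that, for each $j$, the family $(v_i)_{i\in I_j}$ is a basis of $V$. *)

theory Defs
  imports Complex_Main "HOL-Library.Disjoint_Sets"
begin

text \<open>A basis given as a family: repeated vectors are excluded by injectivity. The whole type
  \<open>'b\<close> is the vector space, with scalar multiplication \<open>scale\<close>.\<close>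

definition basis_family ::
  "('a::field \<Rightarrow> 'b::ab_group_add \<Rightarrow> 'b) \<Rightarrow> (nat \<Rightarrow> 'b) \<Rightarrow> nat set \<Rightarrow> bool" where
  "basis_family scale v I \<longleftrightarrow>
     inj_on v I \<and> \<not> module.dependent scale (v ` I) \<and> module.span scale (v ` I) = UNIV"

text \<open>Tuples are functions on the naturals; of a tuple of length \<open>m * k\<close> only the values at
  \<open>1, \<dots>, m * k\<close> are used.\<close>

definition splits_into_bases ::
  "('a::field \<Rightarrow> 'b::ab_group_add \<Rightarrow> 'b) \<Rightarrow> nat \<Rightarrow> nat \<Rightarrow> (nat \<Rightarrow> 'b) \<Rightarrow> bool" where
  "splits_into_bases scale m k v \<longleftrightarrow>
     (\<exists>I :: nat \<Rightarrow> nat set.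
        disjoint_family_on I {1..m} \<and> (\<Union>j\<in>{1..m}. I j) = {1..m * k} \<and>
        (\<forall>j\<in>{1..m}. card (I j) = k \<and> basis_family scale v (I j)))"

end

theory Submission
  imports Defs
begin

text \<open>
  The interesting direction is Edmonds' partition theorem for linear matroids. It is deduced from
  a form of Rado's theorem on independent transversals, applied to the direct sum of \<open>m\<close> copies of
  the matroid: every index \<open>e\<close> starts with the full list \<open>{1..m}\<close> of admissible colours, and
  submodularity of the rank shows that the lists can be shortened one colour at a time, preserving
  the condition \<open>card J \<le> (\<Sum>j. rank {e \<in> J. j \<in> S e})\<close> for all \<open>J\<close>, until each list has one element.
  The condition for \<open>J = {e. S e = {j}}\<close> then says that the \<open>j\<close>-th colour class is independent.
\<close>

text \<open>If deleting \<open>a\<close> and deleting \<open>b\<close> from \<open>S e\<close> both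
  broke the condition, say at \<open>A\<close> and \<open>B\<close>, both sets would contain
  \<open>e\<close>, since sets avoiding \<open>e\<close> do not see the deletion. Uncrossing them by
  submodularity contradicts the condition at \<open>A \<union> B\<close> and
  \<open>A \<inter> B - {e}\<close>.\<close>

lemma rado_list_remove:
  fixes f :: "'c \<Rightarrow> 'a set \<Rightarrow> nat" and S :: "'a \<Rightarrow> 'c set"
  assumes "finite E"
    and mono: "\<And>j A B. j \<in> T \<Longrightarrow> A \<subseteq> B \<Longrightarrow> B \<subseteq> E \<Longrightarrow> f j A \<le> f j B"
    and submod: "\<And>j A B. j \<in> T \<Longrightarrow> A \<subseteq> E \<Longrightarrow> B \<subseteq> E \<Longrightarrow>
      f j (A \<union> B) + f j (A \<inter> B) \<le> f j A + f j B"
    and rado: "\<And>J. J \<subseteq> E \<Longrightarrow> card J \<le> (\<Sum>j\<in>T. f j {x\<in>J. j \<in> S x})"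
    and "a \<noteq> b"
  obtains d where "d \<in> {a, b}"
    "\<And>J. J \<subseteq> E \<Longrightarrow> card J \<le> (\<Sum>j\<in>T. f j {x\<in>J. j \<in> (S(e := S e - {d})) x})"
proof (rule ccontr)
  define R where "R = (\<lambda>d J j. {x\<in>J. j \<in> (S(e := S e - {d})) x})"
  assume "\<not> thesis"
  with that have viol: "\<exists>J\<subseteq>E. (\<Sum>j\<in>T. f j (R d J j)) < card J" if "d \<in> {a, b}" for d
    using \<open>d \<in> {a, b}\<close> unfolding R_def by (meson not_le)
  have "\<exists>J\<subseteq>E. e \<in> J \<and> (\<Sum>j\<in>T. f j (R d J j)) < card J" if d: "d \<in> {a, b}" for d
  proof -
    obtain J where J: "J \<subseteq> E" "(\<Sum>j\<in>T. f j (R d J j)) < card J"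
      using viol[OF d] by blast
    have "e \<in> J"
    proof (rule ccontr)
      assume "e \<notin> J"
      then have "R d J j = {x\<in>J. j \<in> S x}" for j
        by (auto simp: R_def)
      with J rado[of J] show False by simp
    qed
    with J show ?thesis by blast
  qed
  then obtain A B where A: "A \<subseteq> E" "e \<in> A" "(\<Sum>j\<in>T. f j (R a A j)) < card A"
    and B: "B \<subseteq> E" "e \<in> B" "(\<Sum>j\<in>T. f j (R b B j)) < card B"
    by (metis insertCI)
  have fin: "finite A" "finite B"
    using A B \<open>finite E\<close> by (auto intro: finite_subset)
  \<comment> \<open>As \<open>a \<noteq> b\<close>, each colour of \<open>e\<close> survives at
    least one of the two deletions, so the union sees the original lists.\<close>
  have un: "R a A j \<union> R b B j = {x\<in>A \<union> B. j \<in> S x}" for j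
    using A(2) B(2) \<open>a \<noteq> b\<close> by (auto simp: R_def)
  \<comment> \<open>Both \<open>a\<close> and \<open>b\<close> may be lost at \<open>e\<close> in
    the intersection, so \<open>e\<close> is left out; only an inclusion is claimed, and
    monotonicity absorbs it.\<close>
  have int: "{x\<in>A \<inter> B - {e}. j \<in> S x} \<subseteq> R a A j \<inter> R b B j" for j
    by (auto simp: R_def)
  have sub: "R a A j \<subseteq> E" "R b B j \<subseteq> E" for j
    using A(1) B(1) by (auto simp: R_def)
  have "card (A \<union> B) + card (A \<inter> B - {e})
      \<le> (\<Sum>j\<in>T. f j {x\<in>A \<union> B. j \<in> S x}) + (\<Sum>j\<in>T. f j {x\<in>A \<inter> B - {e}. j \<in> S x})"
    using A(1) B(1) by (intro add_mono rado) auto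
  also have "\<dots> \<le> (\<Sum>j\<in>T. f j (R a A j \<union> R b B j)) + (\<Sum>j\<in>T. f j (R a A j \<inter> R b B j))"
    unfolding un using int sub by (intro add_mono order_refl sum_mono mono le_infI1)
  also have "\<dots> \<le> (\<Sum>j\<in>T. f j (R a A j)) + (\<Sum>j\<in>T. f j (R b B j))"
    unfolding sum.distrib[symmetric] using sub by (intro sum_mono submod)
  finally have le: "card (A \<union> B) + card (A \<inter> B - {e})
      \<le> (\<Sum>j\<in>T. f j (R a A j)) + (\<Sum>j\<in>T. f j (R b B j))" .
  \<comment> \<open>Leaving out \<open>e\<close> costs 1, while the two strict violations together
    gain 2.\<close>
  have "card (A \<inter> B) = Suc (card (A \<inter> B - {e}))"
    using A(2) B(2) fin by (intro card.remove) auto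
  with le A(3) B(3) card_Un_Int[OF fin] show False
    by linarith
qed

text \<open>Induction on the total length of the lists. When \<open>f j\<close> is a matroid rank
  function, the final inequality says that the \<open>j\<close>-th colour class is
  independent.\<close>

lemma rado_choice:
  fixes f :: "'c \<Rightarrow> 'a set \<Rightarrow> nat" and S :: "'a \<Rightarrow> 'c set"
  assumes "finite E" "finite T"
    and empty: "\<And>j. j \<in> T \<Longrightarrow> f j {} = 0"
    and mono: "\<And>j A B. j \<in> T \<Longrightarrow> A \<subseteq> B \<Longrightarrow> B \<subseteq> E \<Longrightarrow> f j A \<le> f j B"
    and submod: "\<And>j A B. j \<in> T \<Longrightarrow> A \<subseteq> E \<Longrightarrow> B \<subseteq> E \<Longrightarrow>
      f j (A \<union> B) + f j (A \<inter> B) \<le> f j A + f j B"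
    and "\<And>e. e \<in> E \<Longrightarrow> S e \<subseteq> T"
    and "\<And>J. J \<subseteq> E \<Longrightarrow> card J \<le> (\<Sum>j\<in>T. f j {x\<in>J. j \<in> S x})"
  shows "\<exists>c. (\<forall>e\<in>E. c e \<in> S e) \<and> (\<forall>j\<in>T. card {e\<in>E. c e = j} \<le> f j {e\<in>E. c e = j})"
  using assms(6,7)
proof (induction "\<Sum>e\<in>E. card (S e)" arbitrary: S rule: less_induct)
  case (less S)
  note ST = less.prems(1) and rado = less.prems(2)
  \<comment> \<open>With an empty list the condition at \<open>{e}\<close> would read
    \<open>1 \<le> 0\<close>, because each \<open>f j\<close> vanishes at the empty set.\<close>
  have nonempty: "S e \<noteq> {}" if "e \<in> E" for e
  proof
    assume "S e = {}"
    then have "{x\<in>{e}. j \<in> S x} = {}" for j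
      by auto
    then have "(\<Sum>j\<in>T. f j {x\<in>{e}. j \<in> S x}) = 0"
      by (simp only: empty sum.neutral_const cong: sum.cong)
    with rado[of "{e}"] \<open>e \<in> E\<close> show False by simp
  qed
  show ?case
  proof (cases "\<exists>e\<in>E. \<exists>a\<in>S e. \<exists>b\<in>S e. a \<noteq> b")
    case True
    then obtain e a b where e: "e \<in> E" "a \<in> S e" "b \<in> S e" "a \<noteq> b"
      by blast
    obtain d where d: "d \<in> {a, b}"
      and rado': "\<And>J. J \<subseteq> E \<Longrightarrow> card J \<le> (\<Sum>j\<in>T. f j {x\<in>J. j \<in> (S(e := S e - {d})) x})"
      using rado_list_remove[where f = f and E = E and T = T and S = S and e = e,
          OF \<open>finite E\<close> mono submod rado \<open>a \<noteq> b\<close>] by blast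
    let ?S = "S(e := S e - {d})"
    \<comment> \<open>Finiteness ensures that deleting \<open>d\<close> really lowers the
      cardinality, hence the induction measure.\<close>
    have "finite (S e)"
      using ST[OF e(1)] \<open>finite T\<close> by (rule finite_subset)
    then have "(\<Sum>x\<in>E. card (?S x)) < (\<Sum>x\<in>E. card (S x))"
      using \<open>finite E\<close> d e
      by (intro sum_strict_mono_ex1)
         (auto intro!: bexI[of _ e] psubset_card_mono simp: card_Diff1_le)
    moreover have "?S x \<subseteq> T" if "x \<in> E" for x
      using ST[OF that] by auto
    ultimately obtain c where "\<forall>x\<in>E. c x \<in> ?S x"
      "\<forall>j\<in>T. card {x\<in>E. c x = j} \<le> f j {x\<in>E. c x = j}"
      using less.hyps[of ?S] rado' by blast
    moreover from this(1) have "\<forall>x\<in>E. c x \<in> S x"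
      by (auto split: if_splits)
    ultimately show ?thesis by blast
  next
    case False
    define c where "c = (\<lambda>e. SOME j. j \<in> S e)"
    have c: "c e \<in> S e" if "e \<in> E" for e
      unfolding c_def using nonempty[OF that] by (simp add: some_in_eq)
    with False have S: "S e = {c e}" if "e \<in> E" for e
      using that by blast
    have "card {e\<in>E. c e = j} \<le> f j {e\<in>E. c e = j}" if j: "j \<in> T" for j
    proof -
      let ?J = "{e\<in>E. c e = j}"
      \<comment> \<open>On a single colour class only the summand of that colour has a nonempty
        argument.\<close>
      have "{x\<in>?J. i \<in> S x} = (if i = j then ?J else {})" for i
        using S by auto
      then have "(\<Sum>i\<in>T. f i {x\<in>?J. i \<in> S x}) = (\<Sum>i\<in>T. if i = j then f j ?J else 0)"
        using empty by (intro sum.cong) auto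
      also have "\<dots> = f j ?J"
        using j \<open>finite T\<close> by simp
      finally show ?thesis
        using rado[of ?J] by simp
    qed
    with c show ?thesis by blast
  qed
qed

context finite_dimensional_vector_space
begin

text \<open>Submodularity of the linear rank. For the spans it is the dimension formula for sums of
  subspaces; it becomes an inequality because \<open>A \<inter> B\<close> may span less than
  \<open>span A \<inter> span B\<close>.\<close>

lemma dim_Un_Int_le: "dim (A \<union> B) + dim (A \<inter> B) \<le> dim A + dim B"
proof -
  have "dim (A \<union> B) = dim {x + y |x y. x \<in> span A \<and> y \<in> span B}"
    by (metis dim_span span_Un)
  moreover have "dim (A \<inter> B) \<le> dim (span A \<inter> span B)"
    by (intro dim_subset) (auto intro: span_base)
  ultimately show ?thesis
    using dim_sums_Int[of "span A" "span B"] by simp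
qed

text \<open>The hypothesis closes the chain \<open>dim (v\<close> I) \<le> card (v
  \<open>I) \<le> card I\<close>: equality on the right gives injectivity, on the left
  independence.\<close>

lemma independent_family_if_card_le_dim:
  assumes "finite I" "card I \<le> dim (v ` I)"
  shows "inj_on v I" "independent (v ` I)"
proof -
  have "dim (v ` I) \<le> card (v ` I)"
    using assms(1) by (intro dim_le_card') simp
  with assms card_image_le[of I v] have eq: "card (v ` I) = card I" "card (v ` I) \<le> dim (v ` I)"
    by simp_all
  show "inj_on v I"
    using assms(1) eq(1) by (rule eq_card_imp_inj_on)
  show "independent (v ` I)"
    using assms(1) eq(2) by (intro card_le_dim_spanning[of _ "v ` I"]) (auto intro: span_base)
qed

lemma independent_coloring:
  fixes v :: "'i \<Rightarrow> 'b"
  assumes "finite E" "finite T"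
    and le: "\<And>U. subspace U \<Longrightarrow> card {i\<in>E. v i \<in> U} \<le> card T * dim U"
  obtains c where "c ` E \<subseteq> T"
    "\<And>j. j \<in> T \<Longrightarrow> inj_on v {i\<in>E. c i = j}"
    "\<And>j. j \<in> T \<Longrightarrow> independent (v ` {i\<in>E. c i = j})"
proof -
  have "card J \<le> card T * dim (v ` J)" if "J \<subseteq> E" for J
  proof -
    have "card J \<le> card {i\<in>E. v i \<in> span (v ` J)}"
      using that \<open>finite E\<close> by (intro card_mono) (auto intro: span_base)
    also have "\<dots> \<le> card T * dim (v ` J)"
      using le[of "span (v ` J)"] by simp
    finally show ?thesis .
  qed
  moreover have "dim (v ` (A \<union> B)) + dim (v ` (A \<inter> B)) \<le> dim (v ` A) + dim (v ` B)" for A B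
    using dim_Un_Int_le[of "v ` A" "v ` B"] dim_subset[OF image_Int_subset[of v A B]]
    by (simp add: image_Un)
  ultimately have "\<exists>c. (\<forall>i\<in>E. c i \<in> T) \<and>
      (\<forall>j\<in>T. card {i\<in>E. c i = j} \<le> dim (v ` {i\<in>E. c i = j}))"
    using assms(1,2)
    by (intro rado_choice[where S = "\<lambda>_. T" and f = "\<lambda>_ A. dim (v ` A)"])
       (auto intro!: dim_subset image_mono)
  then obtain c where c: "\<And>i. i \<in> E \<Longrightarrow> c i \<in> T"
    and ind: "\<And>j. j \<in> T \<Longrightarrow> card {i\<in>E. c i = j} \<le> dim (v ` {i\<in>E. c i = j})"
    by blast
  show thesis
  proof
    show "c ` E \<subseteq> T" using c by blast
    fix j assume "j \<in> T"
    with ind show "inj_on v {i\<in>E. c i = j}" "independent (v ` {i\<in>E. c i = j})"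
      using independent_family_if_card_le_dim[of "{i\<in>E. c i = j}" v] \<open>finite E\<close> by auto
  qed
qed

text \<open>Each basis has at most \<open>dim U\<close> members in \<open>U\<close>, since these are
  independent; injectivity lets indices be counted instead of vectors.\<close>

lemma card_le_if_splits_into_bases:
  assumes "splits_into_bases scale m k v" "subspace U"
  shows "card {i \<in> {1..m * k}. v i \<in> U} \<le> m * dim U"
proof -
  obtain I where I: "(\<Union>j\<in>{1..m}. I j) = {1..m * k}"
    "\<And>j. j \<in> {1..m} \<Longrightarrow> basis_family scale v (I j)"
    using assms(1) unfolding splits_into_bases_def by blast
  have le: "card {i\<in>I j. v i \<in> U} \<le> dim U" if "j \<in> {1..m}" for j
  proof -
    have inj: "inj_on v {i\<in>I j. v i \<in> U}" and ind: "independent (v ` I j)"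
      using I(2)[OF that] by (auto simp: basis_family_def intro: inj_on_subset)
    have "card {i\<in>I j. v i \<in> U} = card (v ` {i\<in>I j. v i \<in> U})"
      using inj by (simp add: card_image)
    also have "\<dots> \<le> dim U"
      by (intro independent_card_le_dim independent_mono[OF ind]) auto
    finally show ?thesis .
  qed
  have "{i \<in> {1..m * k}. v i \<in> U} = (\<Union>j\<in>{1..m}. {i\<in>I j. v i \<in> U})"
    using I(1) by blast
  then have "card {i \<in> {1..m * k}. v i \<in> U} \<le> (\<Sum>j\<in>{1..m}. card {i\<in>I j. v i \<in> U})"
    by (simp add: card_UN_le)
  also have "\<dots> \<le> (\<Sum>j\<in>{1..m}. dim U)"
    by (intro sum_mono le)
  finally show ?thesis by simp
qed

lemma splits_into_bases_if_card_le:
  assumes k: "dim (UNIV :: 'b set) = k"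
    and le: "\<And>U. subspace U \<Longrightarrow> card {i \<in> {1..m * k}. v i \<in> U} \<le> m * dim U"
  shows "splits_into_bases scale m k v"
proof -
  obtain c where c: "c ` {1..m * k} \<subseteq> {1..m}"
    and inj: "\<And>j. j \<in> {1..m} \<Longrightarrow> inj_on v {i\<in>{1..m * k}. c i = j}"
    and ind: "\<And>j. j \<in> {1..m} \<Longrightarrow> independent (v ` {i\<in>{1..m * k}. c i = j})"
    using independent_coloring[of "{1..m * k}" "{1..m}" v] le by auto
  define I where "I = (\<lambda>j. {i\<in>{1..m * k}. c i = j})"
  have disj: "disjoint_family_on I {1..m}"
    by (auto simp: disjoint_family_on_def I_def)
  have cover: "(\<Union>j\<in>{1..m}. I j) = {1..m * k}"
    using c by (auto simp: I_def)
  have card_le: "card (I j) \<le> k" if "j \<in> {1..m}" for j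
    using independent_card_le_dim[OF subset_UNIV ind[OF that]] card_image[OF inj[OF that]] k
    by (simp add: I_def)
  have "(\<Sum>j\<in>{1..m}. card (I j)) = card (\<Union>j\<in>{1..m}. I j)"
    using disj by (intro card_UN_disjoint[symmetric]) (auto simp: disjoint_family_on_def I_def)
  also have "\<dots> = (\<Sum>j\<in>{1..m}. k)"
    by (simp only: cover) simp
  \<comment> \<open>The \<open>m\<close> classes have at most \<open>k\<close> elements each and
    \<open>m * k\<close> in total, so no class can fall short.\<close>
  finally have card_eq: "card (I j) = k" if "j \<in> {1..m}" for j
    using sum_mono_inv[of "\<lambda>j. card (I j)" "{1..m}" "\<lambda>_. k"] card_le that by simp
  have "basis_family scale v (I j)" if "j \<in> {1..m}" for j
  proof -
    \<comment> \<open>An independent set with as many elements as the dimension spans.\<close>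
    have "UNIV \<subseteq> span (v ` I j)"
      using card_ge_dim_independent[OF subset_UNIV ind[OF that]]
        card_image[OF inj[OF that]] card_eq[OF that] k by (simp add: I_def)
    with inj[OF that] ind[OF that] show ?thesis
      by (auto simp: basis_family_def I_def)
  qed
  with disj cover card_eq show ?thesis
    unfolding splits_into_bases_def by blast
qed

end

theorem theorem1p3:
  fixes scale :: "'a::field \<Rightarrow> 'b::ab_group_add \<Rightarrow> 'b"
    and k m :: nat
    and v :: "nat \<Rightarrow> 'b"
  assumes "vector_space scale"
    and "k > 0" and "m > 0"
    and "vector_space.dim scale (UNIV :: 'b set) = k"
  shows "splits_into_bases scale m k v \<longleftrightarrow>
    (\<forall>U. module.subspace scale U \<longrightarrow>
       card {i \<in> {1..m * k}. v i \<in> U} \<le> m * vector_space.dim scale U)"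
proof -
  interpret vector_space scale by fact
  obtain B where B: "independent B" "UNIV \<subseteq> span B" "card B = dim (UNIV :: 'b set)"
    by (rule basis_exists[of UNIV]) blast
  \<comment> \<open>An infinite basis would have \<open>card B = 0\<close>, so \<open>k > 0\<close> forces finite dimension.\<close>
  with assms(2,4) have "finite B"
    by (metis card.infinite less_irrefl)
  with B interpret finite_dimensional_vector_space scale B
    by unfold_locales auto
  show ?thesis
    using card_le_if_splits_into_bases splits_into_bases_if_card_le[OF assms(4)] by blast
qed

end
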